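(* Let $\mathcal C$ be a polyhedral closed convex cone in $\mathbb R^N$, and let $f_1,\dots,f_m$ and $g$ be linear functionals on $\mathbb R^N$. Assume that the conditional inequality $$(f_i(\mathbf x)=0\text{ for all } i=1,\dots,m)\ \Rightarrow\ g(\mathbf x)\ge 0$$ holds for all $\mathbf x\in\mathcal C$. Then there exist real numbers $\lambda_1,\dots,\lambda_m$ such that the inequality $$g(\mathbf x)+\sum_{i=1}^m\lambda_i f_i(\mathbf x)\ge 0$$ holds for all $\mathbf x\in\mathcal C$.
   Context: A closed convex cone $\mathcal C\subseteq\mathbb R^N$ is polyhedral if there are finitely many linear functionals $h_1,\dots,h_s$ on $\mathbb R^N$ such that $\mathbf x\in\mathcal C$ if and only if $h_j(\mathbf x)\ge 0$ for all $j=1,\dots,s$. *)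

theory Defs
  imports "HOL-Analysis.Analysis"
begin

definition polyhedral_cone :: "(real ^ 'n) set \<Rightarrow> bool" where
  "polyhedral_cone C \<longleftrightarrow> closed C \<and> convex_cone C \<and>
    (\<exists>(s::nat) (h :: nat \<Rightarrow> real ^ 'n \<Rightarrow> real).
       (\<forall>j\<in>{1..s}. linear (h j)) \<and> (\<forall>x. x \<in> C \<longleftrightarrow> (\<forall>j\<in>{1..s}. h j x \<ge> 0)))"

end

theory Submission
  imports Defs
begin

text \<open>
  By Farkas' lemma, \<open>g\<close> lies in the convex cone generated by the functionals \<open>h j\<close> cutting
  out \<open>C\<close> together with all \<open>f i\<close> and \<open>- f i\<close>. The functionals satisfying the conclusion
  form a convex cone that contains these generators, hence contains \<open>g\<close>.
\<close>

text \<open>A finitely generated convex cone is closed, so a point \<open>b\<close> outside it is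
  strictly separated from it by a hyperplane with some normal \<open>u\<close>. Since the cone is
  stable under scaling, \<open>u\<close> must be nonnegative on all generators while negative on
  \<open>b\<close>, which contradicts \<open>dual\<close>.\<close>

lemma farkas_convex_cone_hull:
  fixes S :: "'a::euclidean_space set"
  assumes "finite S" and dual: "\<And>x. (\<And>a. a \<in> S \<Longrightarrow> 0 \<le> a \<bullet> x) \<Longrightarrow> 0 \<le> b \<bullet> x"
  shows "b \<in> convex_cone hull S"
proof (rule ccontr)
  let ?K = "convex_cone hull S"
  assume "b \<notin> ?K"
  then obtain u \<beta> where ub: "u \<bullet> b < \<beta>" and uK: "\<And>x. x \<in> ?K \<Longrightarrow> \<beta> < u \<bullet> x"
    using separating_hyperplane_closed_point[OF convex_convex_cone_hull
        closed_convex_cone_hull[OF \<open>finite S\<close>]] by blast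
  have "\<beta> < 0"
    using uK[OF convex_cone_hull_contains_0] by simp
  have "0 \<le> a \<bullet> u" if "a \<in> S" for a
  proof (rule ccontr)
    assume "\<not> 0 \<le> a \<bullet> u"
    then have neg: "u \<bullet> a < 0"
      by (simp add: inner_commute)
    \<comment> \<open>The factor is a quotient of two negative numbers, chosen so that
      \<open>u\<close> takes exactly the value \<open>\<beta>\<close> at this multiple of
      \<open>a\<close>; the separation is strict, so no point of the cone can do that.\<close>
    have "(\<beta> / (u \<bullet> a)) *\<^sub>R a \<in> ?K"
      using \<open>\<beta> < 0\<close> neg that
      by (intro convex_cone_hull_mul hull_inc) (auto simp: divide_nonpos_neg)
    from uK[OF this] neg show False
      by simp
  qed
  with dual have "0 \<le> b \<bullet> u"
    by blast
  with ub \<open>\<beta> < 0\<close> show False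
    by (simp add: inner_commute)
qed

text \<open>Riesz representation, with the adjoint at 1 as the representing vector. It turns
  functionals into vectors, to which the cone form of Farkas' lemma applies.\<close>

lemma linear_functional_inner:
  fixes \<phi> :: "'a::euclidean_space \<Rightarrow> real"
  assumes "linear \<phi>"
  obtains v where "\<phi> = (\<lambda>x. v \<bullet> x)"
proof
  show "\<phi> = (\<lambda>x. adjoint \<phi> 1 \<bullet> x)"
    using adjoint_works[OF assms, of _ 1] by (simp add: inner_commute fun_eq_iff)
qed

theorem theorem6:
  fixes C :: "(real ^ 'n) set"
    and m :: nat
    and f :: "nat \<Rightarrow> real ^ 'n \<Rightarrow> real"
    and g :: "real ^ 'n \<Rightarrow> real"
  assumes "polyhedral_cone C"
    and "\<And>i. i \<in> {1..m} \<Longrightarrow> linear (f i)"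
    and "linear g"
    and "\<And>x. x \<in> C \<Longrightarrow> (\<forall>i\<in>{1..m}. f i x = 0) \<Longrightarrow> g x \<ge> 0"
  shows "\<exists>l :: nat \<Rightarrow> real. \<forall>x\<in>C. g x + (\<Sum>i=1..m. l i * f i x) \<ge> 0"
proof -
  obtain s :: nat and h :: "nat \<Rightarrow> real ^ 'n \<Rightarrow> real"
    where h: "\<And>j. j \<in> {1..s} \<Longrightarrow> linear (h j)"
      and C: "\<And>x. x \<in> C \<longleftrightarrow> (\<forall>j\<in>{1..s}. h j x \<ge> 0)"
    using assms(1) unfolding polyhedral_cone_def by blast
  have "\<forall>j\<in>{1..s}. \<exists>v. h j = (\<lambda>x. v \<bullet> x)"
    using h linear_functional_inner by metis
  then obtain p where p: "\<And>j. j \<in> {1..s} \<Longrightarrow> h j = (\<lambda>x. p j \<bullet> x)"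
    by metis
  have "\<forall>i\<in>{1..m}. \<exists>v. f i = (\<lambda>x. v \<bullet> x)"
    using assms(2) linear_functional_inner by metis
  then obtain q where q: "\<And>i. i \<in> {1..m} \<Longrightarrow> f i = (\<lambda>x. q i \<bullet> x)"
    by metis
  obtain r where r: "g = (\<lambda>x. r \<bullet> x)"
    using linear_functional_inner[OF assms(3)] .
  \<comment> \<open>Each equation \<open>f i x = 0\<close> is encoded as a pair of opposite
    inequalities, so a vector is nonnegative against all of \<open>S\<close> exactly when it lies in
    \<open>C\<close> and annihilates every \<open>f i\<close>.\<close>
  define S where "S = p ` {1..s} \<union> q ` {1..m} \<union> (\<lambda>i. - q i) ` {1..m}"
  \<comment> \<open>The vectors that could replace \<open>r\<close> in the conclusion; the
    multipliers may depend on \<open>v\<close> but not on \<open>x\<close>.\<close>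
  define D where "D = {v. \<exists>l. \<forall>x\<in>C. v \<bullet> x + (\<Sum>i=1..m. l i * f i x) \<ge> 0}"
  have "r \<in> convex_cone hull S"
  proof (rule farkas_convex_cone_hull)
    show "finite S"
      by (simp add: S_def)
    fix x assume x: "\<And>a. a \<in> S \<Longrightarrow> 0 \<le> a \<bullet> x"
    have "x \<in> C"
      using x p by (auto simp: C S_def)
    moreover have "f i x = 0" if "i \<in> {1..m}" for i
      using x[of "q i"] x[of "- q i"] that q by (auto simp: S_def)
    ultimately show "0 \<le> r \<bullet> x"
      using assms(4) r by auto
  qed
  also have "convex_cone hull S \<subseteq> D"
  proof (rule hull_minimal)
    have single: "(\<Sum>i=1..m. (if i = k then c else 0) * f i x) = c * f k x"
      if "k \<in> {1..m}" for k c x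
      using that by (simp add: if_distrib[of "\<lambda>t. t * _"] cong: if_cong)
    have "p j \<in> D" if "j \<in> {1..s}" for j
      unfolding D_def using that C p by (auto intro!: exI[of _ "\<lambda>_. 0"])
    \<comment> \<open>The multiplier -1 at index \<open>k\<close> cancels \<open>q k\<close> against
      \<open>f k\<close>, so the expression is identically 0; for \<open>- q k\<close> the
      multiplier 1 does the same.\<close>
    moreover have "q k \<in> D" if "k \<in> {1..m}" for k
      unfolding D_def mem_Collect_eq
      by (rule exI[of _ "\<lambda>i. if i = k then -1 else 0"]) (use that q in \<open>simp only: single; simp\<close>)
    moreover have "- q k \<in> D" if "k \<in> {1..m}" for k
      unfolding D_def mem_Collect_eq
      by (rule exI[of _ "\<lambda>i. if i = k then 1 else 0"]) (use that q in \<open>simp only: single; simp\<close>)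
    ultimately show "S \<subseteq> D"
      by (auto simp: S_def)
    show "convex_cone D"
      unfolding convex_cone_iff
    proof (intro conjI ballI allI impI)
      show "0 \<in> D"
        by (auto simp: D_def intro!: exI[of _ "\<lambda>_. 0"])
    next
      fix v w assume "v \<in> D" "w \<in> D"
      then obtain l l' where "\<forall>x\<in>C. v \<bullet> x + (\<Sum>i=1..m. l i * f i x) \<ge> 0"
        "\<forall>x\<in>C. w \<bullet> x + (\<Sum>i=1..m. l' i * f i x) \<ge> 0"
        by (auto simp: D_def)
      \<comment> \<open>Adding two valid inequalities adds their multipliers; likewise, scaling by
        \<open>c\<close> below scales them.\<close>
      then have "\<forall>x\<in>C. (v + w) \<bullet> x + (\<Sum>i=1..m. (l i + l' i) * f i x) \<ge> 0"
        by (fastforce simp: inner_add_left distrib_right sum.distrib)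
      then show "v + w \<in> D"
        unfolding D_def by (intro CollectI exI[of _ "\<lambda>i. l i + l' i"])
    next
      fix v and c :: real assume "v \<in> D" "0 \<le> c"
      then obtain l where "\<forall>x\<in>C. v \<bullet> x + (\<Sum>i=1..m. l i * f i x) \<ge> 0"
        by (auto simp: D_def)
      with \<open>0 \<le> c\<close> have "\<forall>x\<in>C. c * (v \<bullet> x + (\<Sum>i=1..m. l i * f i x)) \<ge> 0"
        by simp
      then have "\<forall>x\<in>C. (c *\<^sub>R v) \<bullet> x + (\<Sum>i=1..m. (c * l i) * f i x) \<ge> 0"
        by (simp add: distrib_left sum_distrib_left mult.assoc)
      then show "c *\<^sub>R v \<in> D"
        unfolding D_def by (intro CollectI exI[of _ "\<lambda>i. c * l i"])
    qed
  qed
  finally show ?thesis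
    by (simp add: D_def r)
qed

end
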